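(* Let $\alpha>0$ and $0<\beta<1$ be real numbers and $l\geq 1$ an integer. For positive integers $d,q$ define $r=q/\gcd(q,d^l)$ and $$\tau(d,q)=\begin{cases}1 & \text{if } q\mid d^l,\\ \max\{-\alpha r^{-\beta},-1\} & \text{otherwise.}\end{cases}$$ Then there exist constants $C,c_1>0$ depending only on $\alpha,\beta,l$ such that for every $\delta>0$ there exist integers $s>0$ and $1=d_0<d_1<\dots<d_s$ with $d_s\leq C\exp(c_1\delta^{-1/\beta})$, and a real constant $\lambda>0$, such that for every positive integer $q$, $$\frac{1}{\Lambda}\sum_{j=0}^{s}\lambda^j\tau(d_j,q)\geq -\delta,\qquad\text{where } \Lambda=1+\lambda+\dots+\lambda^s.$$ *)

theory Defs
  imports Complex_Main
begin

definition residual :: "nat \<Rightarrow> nat \<Rightarrow> nat \<Rightarrow> nat" where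
  "residual l d q = q div gcd q (d ^ l)"

definition tau :: "real \<Rightarrow> real \<Rightarrow> nat \<Rightarrow> nat \<Rightarrow> nat \<Rightarrow> real" where
  "tau \<alpha> \<beta> l d q =
     (if q dvd d ^ l then 1
      else max (- \<alpha> * real (residual l d q) powr (- \<beta>)) (- 1))"

end

theory Submission
  imports Defs "HOL-Computational_Algebra.Primes"
begin

text \<open>
  Take all weights equal, \<open>s\<close> of order \<open>1/\<delta>\<close>, and a divisibility chain \<open>d\<^sub>0, \<dots>, d\<^sub>s\<close>. If \<open>k\<close> is
  the last index with \<open>q \<nmid> d\<^sub>k\<^sup>l\<close>, then the terms after \<open>k\<close> contribute \<open>s - k\<close>, and a single prime
  \<open>p\<close> with \<open>v\<^sub>p(q) > l v\<^sub>p(d\<^sub>k)\<close> bounds every earlier term from below by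
  \<open>-\<alpha> (p powr -\<beta>) ^ (1 + v\<^sub>p(d\<^sub>k) - v\<^sub>p(d\<^sub>j))\<close>. So only the exponent sequence of one prime at a
  time matters. Primes beyond \<open>(\<alpha>/\<delta>) powr (1/\<beta>)\<close> cost at most \<open>\<delta>\<close> per term and may be
  omitted from the \<open>d\<^sub>j\<close>. Primes up to a constant gain a factor in every step, so that their negative
  terms form a convergent geometric series. Every other prime gains a factor whenever the number of
  remaining steps drops below a member of a geometric progression starting at \<open>\<delta> s\<close> with ratio
  \<open>x = p powr (\<beta>/3)\<close>: as this is slower than \<open>p powr \<beta>\<close>, the negative terms are
  dominated by a constant multiple of \<open>s - k + \<delta> s\<close>, the constant being small for large \<open>p\<close>. Such a
  prime enters with a power at most \<open>p\<close> times a constant power of \<open>1/\<delta>\<close>, and Chebyshev's bound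
  on the primorial yields the required size of \<open>d\<^sub>s\<close>.
\<close>

section \<open>Two elementary estimates: primorials and inverse squares\<close>

text \<open>Erdos' argument: for \<open>n = 2 * m + 1\<close>, the primes in
  \<open>(m + 1, n]\<close> divide \<open>n!\<close> but neither \<open>m!\<close> nor
  \<open>(m + 1)!\<close>, hence all divide \<open>n choose m\<close>. This is one term of a half
  row of binomial coefficients with sum \<open>4 ^ m\<close>.\<close>

lemma primorial_le: "(\<Prod>p\<in>{p. prime p \<and> p \<le> n}. p) \<le> (4::nat) ^ n"
proof (induction n rule: less_induct)
  case (less n)
  consider "n \<le> 2" | "n > 2" "even n" | "n > 2" "odd n" by linarith
  then show ?case
  proof cases
    case 1
    then have "{p::nat. prime p \<and> p \<le> n} = (if n = 2 then {2} else {})"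
      by (auto dest: prime_ge_2_nat)
    then show ?thesis by (simp split: if_splits)
  next
    case 2
    then have "\<not> prime n" using prime_odd_nat by blast
    then have "{p::nat. prime p \<and> p \<le> n} = {p. prime p \<and> p \<le> n - 1}"
      by (auto simp: le_eq_less_or_eq)
    moreover have "(\<Prod>p\<in>{p::nat. prime p \<and> p \<le> n - 1}. p) \<le> 4 ^ (n - 1)"
      using 2 by (intro less.IH) auto
    moreover have "(4::nat) ^ (n - 1) \<le> 4 ^ n" by (intro power_increasing) auto
    ultimately show ?thesis by (simp only:)
  next
    case 3
    then obtain m where m: "n = 2 * m + 1" by (elim oddE)
    let ?A = "{p::nat. prime p \<and> p \<le> m + 1}" and ?B = "{p::nat. prime p \<and> m + 1 < p \<and> p \<le> n}"
    have dvd: "p dvd n choose m" if "p \<in> ?B" for p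
    proof -
      have "p dvd fact m * fact (n - m) * (n choose m)"
        using that m binomial_fact_lemma[of m n]
        by (simp add: prime_dvd_fact_iff del: fact_Suc)
      then show ?thesis
        using that m by (auto simp: prime_dvd_mult_iff prime_dvd_fact_iff simp del: fact_Suc)
    qed
    have "multiplicity p (\<Prod>?B) \<le> multiplicity p (n choose m)" if p: "prime p" for p
    proof -
      have "multiplicity p (\<Prod>?B) = (if p \<in> ?B then 1 else 0)"
        using multiplicity_prod_prime_powers[where f = "\<lambda>_. 1", OF finite_subset[of ?B "{..n}"] _ p]
        by fastforce
      moreover have "multiplicity p (n choose m) \<ge> 1" if "p \<in> ?B"
        using dvd[OF that] p m by (intro multiplicity_geI) auto
      ultimately show ?thesis by presburger
    qed
    then have "\<Prod>?B dvd n choose m"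
      by (intro multiplicity_le_imp_dvd) (auto simp: prod_zero_iff)
    then have "\<Prod>?B \<le> n choose m" using m by (intro dvd_imp_le) auto
    also have "\<dots> \<le> 4 ^ m"
      using member_le_sum[of m "{..m}" "\<lambda>k. 2 * m + 1 choose k"] binomial_r_part_sum[of m] m
      by (simp add: power_mult)
    finally have B: "\<Prod>?B \<le> 4 ^ m" .
    have "{p::nat. prime p \<and> p \<le> n} = ?A \<union> ?B" using m by auto
    then have "\<Prod>{p::nat. prime p \<and> p \<le> n} = \<Prod>?A * \<Prod>?B"
      by (simp only:) (rule prod.union_disjoint, auto)
    also have "\<dots> \<le> 4 ^ (m + 1) * 4 ^ m"
      using less.IH[of "m + 1"] 3 m B by (intro mult_le_mono) auto
    also have "\<dots> = 4 ^ n" unfolding m power_add[symmetric] by (simp add: mult_2)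
    finally show ?thesis .
  qed
qed

text \<open>Telescoping with \<open>1 / (y + 1)^2 \<le> 1 / y - 1 / (y + 1)\<close>; the subtracted
  term is kept to make the induction close.\<close>

lemma sum_inverse_squares_le:
  fixes u :: real
  assumes "u \<ge> 1"
  shows "(\<Sum>v\<le>n. 1 / (u + real v)\<^sup>2) \<le> 2 / u - 1 / (u + real n)"
proof (induction n)
  case 0
  have "1 / u\<^sup>2 \<le> 1 / u" using assms by (simp add: field_simps power2_eq_square)
  then show ?case by simp
next
  case (Suc n)
  define y where "y = u + real n"
  have "y > 0" using assms by (simp add: y_def)
  then have "1 / (y + 1)\<^sup>2 \<le> 1 / (y * (y + 1))"
    by (intro divide_left_mono) (auto simp: power2_eq_square)
  also have "\<dots> = 1 / y - 1 / (y + 1)" using \<open>y > 0\<close> by (simp add: field_simps)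
  finally have "1 / (y + 1)\<^sup>2 \<le> 1 / y - 1 / (y + 1)" .
  with Suc show ?case by (simp add: y_def add_ac)
qed

section \<open>Reduction to the exponents of a single prime\<close>

text \<open>The gcd removes at most \<open>l * multiplicity p d\<close> factors \<open>p\<close>
  from \<open>q\<close>, so \<open>p ^ n\<close> divides the residual. The cut-off at -1 can only
  raise the value.\<close>

lemma tau_ge_of_multiplicity:
  assumes "\<alpha> > 0" "\<beta> > 0" "prime p" "q > 0" "d > 0"
    and n: "n > 0" "n + l * multiplicity p d \<le> multiplicity p q"
  shows "tau \<alpha> \<beta> l d q \<ge> - \<alpha> * (real p powr - \<beta>) ^ n"
proof -
  let ?g = "gcd q (d ^ l)"
  have md: "multiplicity p (d ^ l) = l * multiplicity p d"
    using assms by (simp add: prime_elem_multiplicity_power_distrib)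
  have "\<not> q dvd d ^ l"
    using dvd_imp_multiplicity_le[of q "d ^ l" p] n md assms by auto
  moreover have "residual l d q \<ge> p ^ n"
  proof -
    have qr: "q = residual l d q * ?g" by (simp add: residual_def)
    then have r: "residual l d q > 0" "?g > 0" using assms by (auto intro: Nat.gr0I)
    have "multiplicity p q = multiplicity p (residual l d q) + multiplicity p ?g"
      using r assms prime_elem_multiplicity_mult_distrib[of p "residual l d q" ?g]
      by (metis qr neq0_conv prime_imp_prime_elem)
    moreover have "multiplicity p ?g \<le> l * multiplicity p d"
      using dvd_imp_multiplicity_le[of ?g "d ^ l" p] md assms by simp
    ultimately have "p ^ n dvd residual l d q"
      using n by (intro multiplicity_dvd') auto
    then show ?thesis using r by (intro dvd_imp_le) auto
  qed
  then have "real (residual l d q) powr - \<beta> \<le> real (p ^ n) powr - \<beta>"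
    using assms prime_gt_0_nat[of p] by (intro powr_mono2') (auto simp del: of_nat_power)
  moreover have "real (p ^ n) powr - \<beta> = (real p powr - \<beta>) ^ n"
    by (simp add: powr_power prime_gt_0_nat assms powr_powr flip: powr_realpow)
      (simp add: mult.commute)
  ultimately show ?thesis using assms by (simp add: tau_def le_max_iff_disj)
qed

text \<open>The strict increase after \<open>k\<close> holds because \<open>q\<close> divides
  \<open>d (Suc k) ^ l\<close> while \<open>p\<close> occurs too often in \<open>q\<close> for
  \<open>d k ^ l\<close>. It ties \<open>k\<close> to a step at which \<open>p\<close> gains a
  factor, which is needed to compare the negative terms with \<open>s - k\<close>.\<close>

lemma sum_tau_ge:
  assumes "\<alpha> > 0" "\<beta> > 0" "l \<ge> 1" "q > 0"
    and pos: "\<And>j. d j > 0" and chain: "\<And>i j. i \<le> j \<Longrightarrow> d i dvd d j"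
  obtains "(\<Sum>j=0..s. tau \<alpha> \<beta> l (d j) q) \<ge> 0"
  | p k where "prime p" "k \<le> s" "k < s \<Longrightarrow> multiplicity p (d k) < multiplicity p (d (Suc k))"
      "(\<Sum>j=0..s. tau \<alpha> \<beta> l (d j) q) \<ge> real (s - k) -
        \<alpha> * (\<Sum>j\<le>k. (real p powr - \<beta>) ^ (1 + (multiplicity p (d k) - multiplicity p (d j))))"
proof (cases "\<forall>j\<le>s. q dvd d j ^ l")
  case True
  then have "(\<Sum>j=0..s. tau \<alpha> \<beta> l (d j) q) \<ge> 0" by (intro sum_nonneg) (auto simp: tau_def)
  then show ?thesis by (rule that(1))
next
  case False
  let ?K = "{j. j \<le> s \<and> \<not> q dvd d j ^ l}"
  define k where "k = Max ?K"
  have K: "finite ?K" "?K \<noteq> {}" using False by auto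
  then have k: "k \<le> s" "\<not> q dvd d k ^ l" using Max_in[OF K] by (auto simp: k_def)
  have after: "q dvd d j ^ l" if "k < j" "j \<le> s" for j
    using Max_ge[OF K(1), of j] that by (fastforce simp: k_def)
  obtain p where p: "prime p" "multiplicity p q > multiplicity p (d k ^ l)"
    using k multiplicity_le_imp_dvd[of q "d k ^ l"] assms by (metis neq0_conv not_le)
  have md: "multiplicity p (d j ^ l) = l * multiplicity p (d j)" for j
    using pos[of j] p by (simp add: prime_elem_multiplicity_power_distrib)
  have mono: "multiplicity p (d i) \<le> multiplicity p (d j)" if "i \<le> j" for i j
    using chain[OF that] pos[of j] by (intro dvd_imp_multiplicity_le) auto
  have "multiplicity p (d k) < multiplicity p (d (Suc k))" if "k < s"
  proof -
    have "multiplicity p q \<le> multiplicity p (d (Suc k) ^ l)"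
      using after[of "Suc k"] that pos[of "Suc k"] by (intro dvd_imp_multiplicity_le) auto
    then have "l * multiplicity p (d k) < l * multiplicity p (d (Suc k))"
      using p md by (metis le_less_trans not_le)
    then show ?thesis by simp
  qed
  moreover have "(\<Sum>j=0..s. tau \<alpha> \<beta> l (d j) q) \<ge> real (s - k) -
        \<alpha> * (\<Sum>j\<le>k. (real p powr - \<beta>) ^ (1 + (multiplicity p (d k) - multiplicity p (d j))))"
  proof -
    let ?f = "\<lambda>j. \<alpha> * (real p powr - \<beta>) ^ (1 + (multiplicity p (d k) - multiplicity p (d j)))"
    have "tau \<alpha> \<beta> l (d j) q \<ge> - ?f j" if "j \<le> k" for j
    proof -
      let ?n = "1 + (multiplicity p (d k) - multiplicity p (d j))"
      \<comment> \<open>Dropping the factor \<open>l\<close> here keeps all later constants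
        independent of \<open>l\<close>.\<close>
      have "multiplicity p (d k) - multiplicity p (d j)
          \<le> l * (multiplicity p (d k) - multiplicity p (d j))"
        using assms by simp
      moreover have "l * (multiplicity p (d k) - multiplicity p (d j)) + l * multiplicity p (d j)
          = l * multiplicity p (d k)"
        using mono[OF that] by (simp flip: distrib_left)
      ultimately have "?n + l * multiplicity p (d j) \<le> multiplicity p q"
        using p md[of k] by linarith
      then show ?thesis
        using tau_ge_of_multiplicity[of \<alpha> \<beta> p q "d j" ?n l] assms p pos by simp
    qed
    then have "(\<Sum>j\<le>k. tau \<alpha> \<beta> l (d j) q) \<ge> (\<Sum>j\<le>k. - ?f j)" by (intro sum_mono) auto
    moreover have "(\<Sum>j\<in>{k<..s}. tau \<alpha> \<beta> l (d j) q) = real (s - k)"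
      using after by (simp add: tau_def)
    moreover have "(\<Sum>j=0..s. tau \<alpha> \<beta> l (d j) q)
        = (\<Sum>j\<le>k. tau \<alpha> \<beta> l (d j) q) + (\<Sum>j\<in>{k<..s}. tau \<alpha> \<beta> l (d j) q)"
    proof -
      have "{0..s} = {..k} \<union> {k<..s}" using k by auto
      then show ?thesis by (simp only:) (rule sum.union_disjoint, auto)
    qed
    ultimately show ?thesis by (simp add: sum_negf sum_distrib_left)
  qed
  ultimately show ?thesis using p k that(2) by blast
qed

section \<open>Summing the negative terms for one prime\<close>

text \<open>Meant for the small primes, which gain one factor in every step.\<close>

lemma sum_power_le_geometric:
  fixes w :: real
  assumes "0 \<le> w" "w < 1"
  shows "(\<Sum>j\<le>k. w ^ (1 + (k - j))) \<le> 1 / (1 - w)"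
proof -
  have "(\<Sum>j\<le>k. w ^ (1 + (k - j))) = (\<Sum>j\<le>k. w ^ (1 + j))"
    by (rule sum.reindex_bij_witness[of _ "\<lambda>j. k - j" "\<lambda>j. k - j"]) auto
  also have "\<dots> \<le> (\<Sum>j\<le>k. w ^ j)"
    using assms by (intro sum_mono) (auto intro: mult_left_le_one_le)
  also have "\<dots> \<le> (\<Sum>j. w ^ j)"
    using assms by (intro sum_le_suminf) (auto intro: summable_geometric)
  also have "\<dots> = 1 / (1 - w)" using assms by (intro suminf_geometric) auto
  finally show ?thesis .
qed

text \<open>
  With \<open>v\<close> steps remaining, a prime still has to receive \<open>threshold u x v\<close> of its factors.
\<close>

definition threshold :: "real \<Rightarrow> real \<Rightarrow> nat \<Rightarrow> nat" where
  "threshold u x v = (LEAST i. real v \<le> u * x ^ i)"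

lemma threshold_le:
  assumes "u > 0" "x > 1"
  shows "real v \<le> u * x ^ threshold u x v"
proof -
  obtain i where "real v / u < x ^ i" using real_arch_pow[OF assms(2)] by blast
  then have "real v \<le> u * x ^ i" using assms by (simp add: field_simps)
  then show ?thesis unfolding threshold_def by (rule LeastI)
qed

lemma threshold_less:
  assumes "i < threshold u x v"
  shows "u * x ^ i < real v"
  using not_less_Least[OF assms[unfolded threshold_def]] by simp

lemma threshold_mono:
  assumes "u > 0" "x > 1" "v \<le> v'"
  shows "threshold u x v \<le> threshold u x v'"
proof -
  have "real v \<le> u * x ^ threshold u x v'"
    using threshold_le[OF assms(1,2), of v'] assms(3) by linarith
  then show ?thesis unfolding threshold_def[of _ _ v] by (rule Least_le)
qed

lemma threshold_zero: "u > 0 \<Longrightarrow> threshold u x 0 = 0"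
  unfolding threshold_def by (rule Least_eq_0) simp

text \<open>Let \<open>U\<close> be the member of the progression just below the threshold at
  \<open>k\<close>. With \<open>v = s - j\<close> steps remaining, the gain in exponent forces
  \<open>U + v \<le> 2 * U * x ^ n\<close>, so the term is at most
  \<open>4 * U^2 / (U + v)^2\<close>, and these add up to at most \<open>8 * U\<close>.\<close>

lemma sum_power_threshold_le:
  fixes u x :: real
  assumes u: "u \<ge> 1" and x: "x > 1" and "k \<le> s"
    and drop: "k < s \<Longrightarrow> threshold u x (s - Suc k) < threshold u x (s - k)"
  shows "(\<Sum>j\<le>k. (1 / x) ^ (2 * (1 + (threshold u x (s - j) - threshold u x (s - k)))))
           \<le> 8 * (real (s - k) + u)"
proof -
  let ?t = "\<lambda>j. threshold u x (s - j)"
  \<comment> \<open>For \<open>k < s\<close> the drop makes \<open>?t k\<close> positive, and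
    minimality gives \<open>U < s - k\<close>. For \<open>k = s\<close> the truncated subtraction
    gives \<open>U = u\<close>.\<close>
  define U where "U = u * x ^ (?t k - 1)"
  have "1 * 1 \<le> U" unfolding U_def using u x by (intro mult_mono) auto
  then have U1: "U \<ge> 1" by simp
  have Ule: "U \<le> real (s - k) + u"
  proof (cases "k < s")
    case True
    then show ?thesis using threshold_less[of "?t k - 1" u x "s - k"] drop u by (simp add: U_def)
  next
    case False
    then show ?thesis using \<open>k \<le> s\<close> threshold_zero[of u x] u by (simp add: U_def)
  qed
  have point: "(1 / x) ^ (2 * (1 + (?t j - ?t k))) \<le> 4 * U\<^sup>2 * (1 / (U + real (s - j))\<^sup>2)"
    if "j \<le> k" for j
  proof -
    let ?n = "1 + (?t j - ?t k)"
    have "?t k \<le> ?t j" using that u x by (intro threshold_mono) auto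
    \<comment> \<open>The extra 1 in \<open>?n\<close> makes up for the 1 subtracted in
      \<open>U\<close>.\<close>
    then have "?t j \<le> (?t k - 1) + ?n" by simp
    then have "u * x ^ ?t j \<le> u * x ^ ((?t k - 1) + ?n)"
      using u x by (intro mult_left_mono power_increasing) auto
    also have "\<dots> = U * x ^ ?n" by (simp only: U_def power_add mult.assoc)
    finally have "real (s - j) \<le> U * x ^ ?n"
      using threshold_le[of u x "s - j"] u x by simp
    moreover have "U \<le> U * x ^ ?n"
      using U1 x mult_left_mono[OF one_le_power[of x ?n], of U] by simp
    ultimately have "U + real (s - j) \<le> 2 * U * x ^ ?n" by linarith
    then have "(U + real (s - j))\<^sup>2 \<le> (2 * U * x ^ ?n)\<^sup>2" using U1 by (intro power_mono) auto
    then have "(U + real (s - j))\<^sup>2 \<le> 4 * U\<^sup>2 * x ^ (2 * ?n)"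
      by (simp only: power_mult_distrib power_even_eq) simp
    moreover have "(U + real (s - j))\<^sup>2 > 0" "x ^ (2 * ?n) > 0" using U1 x by auto
    ultimately show ?thesis
      by (simp only: power_one_over) (simp add: field_simps del: mult_Suc_right power_Suc)
  qed
  have "(\<Sum>j\<le>k. (1 / x) ^ (2 * (1 + (?t j - ?t k))))
      \<le> (\<Sum>j\<le>k. 4 * U\<^sup>2 * (1 / (U + real (s - j))\<^sup>2))"
    using point by (intro sum_mono) auto
  also have "\<dots> \<le> (\<Sum>j\<le>s. 4 * U\<^sup>2 * (1 / (U + real (s - j))\<^sup>2))"
    using \<open>k \<le> s\<close> by (intro sum_mono2) auto
  also have "\<dots> = 4 * U\<^sup>2 * (\<Sum>v\<le>s. 1 / (U + real v)\<^sup>2)"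
    unfolding sum_distrib_left
    by (rule sum.reindex_bij_witness[of _ "\<lambda>j. s - j" "\<lambda>j. s - j"]) auto
  also have "\<dots> \<le> 4 * U\<^sup>2 * (2 / U)"
  proof -
    have "2 / U - 1 / (U + real s) \<le> 2 / U" using U1 by simp
    with sum_inverse_squares_le[OF U1, of s] have "(\<Sum>v\<le>s. 1 / (U + real v)\<^sup>2) \<le> 2 / U"
      by (rule order_trans)
    then show ?thesis by (intro mult_left_mono) auto
  qed
  also have "\<dots> = 8 * U" using U1 by (simp add: power2_eq_square)
  finally show ?thesis using Ule by simp
qed

section \<open>Size of products of prime powers\<close>

lemma primorial_le_exp: "real (\<Prod>p\<in>{p. prime p \<and> p \<le> n}. p) \<le> exp (2 * real n)"
proof -
  have exp2: "(4::real) \<le> exp 2"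
    using mult_mono[OF exp_ge_add_one_self[of 1] exp_ge_add_one_self[of 1]]
    by (simp flip: exp_add)
  have "real (\<Prod>p\<in>{p. prime p \<and> p \<le> n}. p) \<le> real (4 ^ n)"
    using primorial_le[of n] by (simp only: of_nat_le_iff)
  also have "\<dots> \<le> exp 2 ^ n" using exp2 by (simp add: power_mono)
  also have "\<dots> = exp (2 * real n)" by (simp add: exp_of_nat_mult[symmetric] mult.commute)
  finally show ?thesis .
qed

text \<open>To be used with \<open>Y\<close> of order \<open>\<delta> powr (- 1 / \<beta>)\<close>:
  an extra factor \<open>Y ^ 3\<close> at each prime still leaves the logarithm of the product
  linear in \<open>Y\<close>.\<close>

lemma prod_prime_powers_le_exp:
  fixes Y :: real
  assumes "Y \<ge> 1" "real N \<le> Y"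
    and f: "\<And>p. prime p \<Longrightarrow> p \<le> N \<Longrightarrow> real (p ^ f p) \<le> real p * Y ^ 3"
  shows "real (\<Prod>p\<in>{p. prime p \<and> p \<le> N}. p ^ f p) \<le> exp (22 * Y)"
proof -
  let ?S = "{p::nat. prime p \<and> p \<le> N}" and ?T = "{p::nat. real p \<le> sqrt Y}"
  \<comment> \<open>Above \<open>sqrt Y\<close> a prime absorbs \<open>Y ^ 3\<close> into \<open>p ^ 6\<close>; below there are too few primes to matter.\<close>
  have le: "real (p ^ f p) \<le> real p ^ 7 * (if p \<in> ?T then Y ^ 4 else 1)" if "p \<in> ?S" for p
  proof (cases "p \<in> ?T")
    case True
    have "real p \<ge> 1" using that prime_gt_0_nat[of p] by simp
    have "real (p ^ f p) \<le> real p * Y ^ 3" using f that by auto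
    also have "\<dots> \<le> real p ^ 7 * Y ^ 4"
      using \<open>real p \<ge> 1\<close> \<open>Y \<ge> 1\<close> power_increasing[of 1 7 "real p"] power_increasing[of 3 4 Y]
      by (intro mult_mono) auto
    finally show ?thesis using True by simp
  next
    case False
    then have "sqrt Y ^ 2 \<le> real p ^ 2" using \<open>Y \<ge> 1\<close> by (intro power_mono) auto
    then have "Y \<le> real p ^ 2" using \<open>Y \<ge> 1\<close> by simp
    then have "Y ^ 3 \<le> (real p ^ 2) ^ 3" using \<open>Y \<ge> 1\<close> by (intro power_mono) auto
    then have "real p * Y ^ 3 \<le> real p * (real p ^ 2) ^ 3" by (intro mult_left_mono) auto
    also have "\<dots> = real p ^ 7" by (simp add: power_numeral_reduce)
    finally show ?thesis using f[of p] that False by auto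
  qed
  have "real (\<Prod>p\<in>?S. p ^ f p) \<le> (\<Prod>p\<in>?S. real p ^ 7 * (if p \<in> ?T then Y ^ 4 else 1))"
    unfolding of_nat_prod using le by (intro prod_mono) auto
  also have "\<dots> = real (\<Prod>?S) ^ 7 * (Y ^ 4) ^ card (?S \<inter> ?T)"
    by (simp add: prod.distrib prod_power_distrib prod.If_cases del: Int_Collect Collect_conj_eq)
  \<comment> \<open>The seventh power of the primorial gives 14. At most \<open>sqrt Y\<close>
    primes carry \<open>Y ^ 4 \<le> exp (8 * sqrt Y)\<close>, which gives 8.\<close>
  also have "\<dots> \<le> exp (14 * Y) * exp (8 * Y)"
  proof (rule mult_mono)
    have "real (\<Prod>?S) \<le> exp (2 * real N)" by (rule primorial_le_exp)
    also have "\<dots> \<le> exp (2 * Y)" using assms by simp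
    finally have "real (\<Prod>?S) ^ 7 \<le> exp (2 * Y) ^ 7" by (intro power_mono) (auto intro: prod_nonneg)
    then show "real (\<Prod>?S) ^ 7 \<le> exp (14 * Y)" by (simp flip: exp_of_nat_mult)
    have "?S \<inter> ?T \<subseteq> {1..nat \<lfloor>sqrt Y\<rfloor>}"
      by (auto simp: le_nat_floor dest: prime_gt_0_nat)
    from card_mono[OF _ this] have "card (?S \<inter> ?T) \<le> nat \<lfloor>sqrt Y\<rfloor>" by simp
    moreover have "real (nat \<lfloor>sqrt Y\<rfloor>) \<le> sqrt Y" using \<open>Y \<ge> 1\<close> by (intro of_nat_floor) auto
    ultimately have c: "real (card (?S \<inter> ?T)) \<le> sqrt Y" by linarith
    have "sqrt Y \<le> exp (sqrt Y)" using exp_ge_add_one_self[of "sqrt Y"] by linarith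
    then have "sqrt Y ^ 8 \<le> exp (sqrt Y) ^ 8" using \<open>Y \<ge> 1\<close> by (intro power_mono) auto
    moreover have "sqrt Y ^ 8 = (sqrt Y ^ 2) ^ 4" by simp
    ultimately have "Y ^ 4 \<le> exp (8 * sqrt Y)" using \<open>Y \<ge> 1\<close> by (simp flip: exp_of_nat_mult)
    then have "(Y ^ 4) ^ card (?S \<inter> ?T) \<le> exp (8 * sqrt Y) ^ card (?S \<inter> ?T)"
      using \<open>Y \<ge> 1\<close> by (intro power_mono) auto
    also have "\<dots> = exp (real (card (?S \<inter> ?T)) * (8 * sqrt Y))" by (simp add: exp_of_nat_mult)
    also have "\<dots> \<le> exp (sqrt Y * (8 * sqrt Y))"
      using \<open>Y \<ge> 1\<close> by (intro exp_le_cancel_iff[THEN iffD2] mult_right_mono c) auto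
    also have "\<dots> = exp (8 * Y)" using \<open>Y \<ge> 1\<close> by (simp add: mult.left_commute[of _ 8])
    finally show "(Y ^ 4) ^ card (?S \<inter> ?T) \<le> exp (8 * Y)" .
  qed (use \<open>Y \<ge> 1\<close> in \<open>auto intro!: prod_nonneg\<close>)
  also have "\<dots> = exp (22 * Y)" by (simp flip: exp_add)
  finally show ?thesis .
qed

section \<open>Construction of the chain and conclusion\<close>

theorem theorem3:
  fixes \<alpha> \<beta> :: real and l :: nat
  assumes "\<alpha> > 0" and "0 < \<beta>" and "\<beta> < 1" and "l \<ge> 1"
  shows "\<exists>C c\<^sub>1 :: real. C > 0 \<and> c\<^sub>1 > 0 \<and>
    (\<forall>\<delta>::real. \<delta> > 0 \<longrightarrow>
      (\<exists>(s::nat) (d :: nat \<Rightarrow> nat) (lam::real).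
         s > 0 \<and> d 0 = 1 \<and> (\<forall>j<s. d j < d (Suc j)) \<and>
         real (d s) \<le> C * exp (c\<^sub>1 * \<delta> powr (- 1 / \<beta>)) \<and>
         lam > 0 \<and>
         (\<forall>q::nat. q > 0 \<longrightarrow>
            1 / (\<Sum>j=0..s. lam ^ j) * (\<Sum>j=0..s. lam ^ j * tau \<alpha> \<beta> l (d j) q) \<ge> - \<delta>)))"
proof -
  \<comment> \<open>For \<open>p > B\<close> this gives
    \<open>\<alpha> / p powr (\<beta> / 3) \<le> 1 / 8\<close>, cancelling the 8 in
    \<open>sum_power_threshold_le\<close>. The bound 2 puts the prime 2 among the small
    primes.\<close>
  define B where "B = nat \<lceil>max 2 ((8 * \<alpha>) powr (3 / \<beta>))\<rceil>"
  define w where "w = 2 powr - \<beta>"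
  \<comment> \<open>Here \<open>w\<close> is the largest ratio \<open>p powr - \<beta>\<close>;
    \<open>\<delta> * s \<ge> K\<close> pays for the geometric series of a small prime and gives
    \<open>u \<ge> 1\<close>.\<close>
  define K where "K = 1 + \<alpha> / (1 - w)"
  define A where "A = \<alpha> powr (1 / \<beta>) + real B + 1"
  \<comment> \<open>The first summand accounts for the primes up to \<open>B\<close>, raised to the
    power \<open>s\<close>; the second for the others, all at most
    \<open>A * \<delta> powr (- 1 / \<beta>)\<close>.\<close>
  define c where "c = 2 * real B * (K + 1) + 22 * A"
  have B: "real B \<ge> 2" "real B \<ge> (8 * \<alpha>) powr (3 / \<beta>)"
    unfolding B_def by linarith+
  have "w < 2 powr 0" unfolding w_def using assms by (intro powr_less_mono) auto
  then have w: "0 < w" "w < 1" by (auto simp: w_def)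
  then have K: "K \<ge> 1" using assms by (simp add: K_def)
  have A: "A \<ge> 1" unfolding A_def by simp
  have c: "c > 0" using K A by (simp add: c_def add_nonneg_pos)
  have main: "\<exists>(s::nat) (d :: nat \<Rightarrow> nat). s > 0 \<and> d 0 = 1 \<and> (\<forall>j<s. d j < d (Suc j)) \<and>
         real (d s) \<le> 2 * exp (c * \<delta> powr (- 1 / \<beta>)) \<and>
         (\<forall>q::nat. q > 0 \<longrightarrow> (\<Sum>j=0..s. tau \<alpha> \<beta> l (d j) q) \<ge> - \<delta> * (real s + 1))"
    if "\<delta> > 0" for \<delta>
  proof (cases "\<delta> < 1")
    case False
    \<comment> \<open>For \<open>\<delta> \<ge> 1\<close> the cut-off at -1 suffices, so the chain
      1, 2 works; only this case uses the factor \<open>C = 2\<close>.\<close>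
    have lower: "tau \<alpha> \<beta> l (2 ^ j) q \<ge> - \<delta>" for j q
      using False by (simp add: tau_def le_max_iff_disj)
    have "(\<Sum>j=0..1. tau \<alpha> \<beta> l (2 ^ j) q) \<ge> - \<delta> * (real 1 + 1)" for q
      using lower[of 0 q] lower[of 1 q] by simp
    moreover have "real (2 ^ 1) \<le> 2 * exp (c * \<delta> powr (- 1 / \<beta>))" using c by simp
    ultimately show ?thesis by (intro exI[of _ 1] exI[of _ "\<lambda>j. 2 ^ j"]) auto
  next
    case True
    define D where "D = \<delta> powr (- 1 / \<beta>)"
    define s where "s = nat \<lceil>K / \<delta>\<rceil>"
    define u where "u = \<delta> * real s"
    define M where "M = max B (nat \<lfloor>(\<alpha> / \<delta>) powr (1 / \<beta>)\<rfloor>)"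
    define x where "x = (\<lambda>p. real p powr (\<beta> / 3))"
    \<comment> \<open>For \<open>p > B\<close> the exponent is the amount by which the threshold has
      fallen as the remaining steps go from \<open>s\<close> to \<open>s - j\<close>.\<close>
    define e where "e = (\<lambda>p j. if p \<le> B then j
      else threshold u (x p) s - threshold u (x p) (s - j))"
    define d where "d = (\<lambda>j. \<Prod>p\<in>{p. prime p \<and> p \<le> M}. p ^ e p j)"
    have inv\<delta>: "1 / \<delta> \<ge> 1" using that True by simp
    have D\<beta>: "D powr \<beta> = 1 / \<delta>"
      unfolding D_def powr_powr using that assms by (simp add: powr_minus_divide)
    \<comment> \<open>Since \<open>\<beta> < 1\<close>, the length \<open>s\<close>, of order
      \<open>1 / \<delta>\<close>, is at most of order \<open>D\<close>.\<close>
    have "1 / \<delta> = \<delta> powr (- 1)" using that by (simp add: powr_minus_divide)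
    also have "\<dots> \<le> D"
      unfolding D_def using that True assms by (intro powr_mono') (auto simp: field_simps)
    finally have D: "1 / \<delta> \<le> D" .
    then have D1: "D \<ge> 1" using inv\<delta> by linarith
    have s_ge: "real s \<ge> K / \<delta>" unfolding s_def by linarith
    have "K / \<delta> > 0" using K that by simp
    then have s0: "s > 0" unfolding s_def by simp
    have uK: "u \<ge> K" using s_ge that by (simp add: u_def field_simps)
    then have u: "u \<ge> 1" using K by linarith
    have "real s \<le> K / \<delta> + 1" unfolding s_def using \<open>K / \<delta> > 0\<close> by linarith
    also have "\<dots> \<le> (K + 1) * (1 / \<delta>)" using inv\<delta> by (simp add: add_divide_distrib)
    also have "\<dots> \<le> (K + 1) * D" using D K by (intro mult_left_mono) auto
    finally have s_le: "real s \<le> (K + 1) * D" .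
    have x: "x p > 1" "\<alpha> * (1 / x p) \<le> 1 / 8" if "p > B" for p
    proof -
      have "real p > 1" using that B by linarith
      then show "x p > 1" using assms by (simp add: x_def gr_one_powr)
      have "8 * \<alpha> = ((8 * \<alpha>) powr (3 / \<beta>)) powr (\<beta> / 3)"
        using assms by (simp add: powr_powr)
      also have "\<dots> \<le> x p"
        unfolding x_def using that B assms by (intro powr_mono2) auto
      finally show "\<alpha> * (1 / x p) \<le> 1 / 8" using \<open>x p > 1\<close> by (simp add: field_simps)
    qed
    have e_mono: "e p i \<le> e p j" if "i \<le> j" for p i j
    proof (cases "p \<le> B")
      case False
      then have "threshold u (x p) (s - j) \<le> threshold u (x p) (s - i)"
        using that x[of p] u by (intro threshold_mono) auto
      then show ?thesis by (simp add: e_def False)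
    qed (use that in \<open>simp add: e_def\<close>)
    have d_pos: "d j > 0" for j
      by (auto simp: d_def prime_gt_0_nat intro!: prod_pos)
    have mult_d: "multiplicity p (d j) = (if p \<le> M then e p j else 0)" if "prime p" for p j
      unfolding d_def by (subst multiplicity_prod_prime_powers) (use that in auto)
    have d_dvd: "d i dvd d j" if "i \<le> j" for i j
      unfolding d_def using e_mono[OF that] by (intro prod_dvd_prod le_imp_power_dvd)
    have "e p 0 = 0" for p by (simp add: e_def)
    then have d0: "d 0 = 1" by (simp add: d_def)
    have d_less: "d j < d (Suc j)" for j
    proof -
      \<comment> \<open>The prime 2 has exponent exactly \<open>j\<close> in
        \<open>d j\<close>.\<close>
      have "multiplicity 2 (d j) \<noteq> multiplicity 2 (d (Suc j))"
        using B by (simp add: mult_d e_def M_def)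
      then show ?thesis
        using dvd_imp_le[OF d_dvd[of j "Suc j"] d_pos[of "Suc j"]] by (auto simp: le_less)
    qed
    have \<alpha>\<delta>: "(\<alpha> / \<delta>) powr (1 / \<beta>) = \<alpha> powr (1 / \<beta>) * D"
      using assms that by (simp add: D_def powr_divide powr_minus_divide)

    \<comment> \<open>Size of the last member of the chain\<close>
    have size: "real (d s) \<le> exp (c * D)"
    proof -
      let ?f = "\<lambda>p. if p \<le> B then 0 else threshold u (x p) s"
      have "threshold u (x p) 0 = 0" for p using u by (intro threshold_zero) auto
      then have "d s = (\<Prod>p\<in>{p. prime p \<and> p \<le> M}. (if p \<le> B then p ^ s else 1) * p ^ ?f p)"
        unfolding d_def by (intro prod.cong) (auto simp: e_def)
      also have "\<dots> = (\<Prod>p\<in>{p. prime p \<and> p \<le> M}. if p \<le> B then p ^ s else 1) *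
          (\<Prod>p\<in>{p. prime p \<and> p \<le> M}. p ^ ?f p)" by (rule prod.distrib)
      also have "(\<Prod>p\<in>{p. prime p \<and> p \<le> M}. if p \<le> B then p ^ s else 1)
          = (\<Prod>p\<in>{p. prime p \<and> p \<le> B}. p) ^ s"
        unfolding prod_power_distrib
        by (intro prod.mono_neutral_cong_right) (auto simp: M_def)
      finally have ds: "real (d s) = real (\<Prod>p\<in>{p. prime p \<and> p \<le> B}. p) ^ s *
          real (\<Prod>p\<in>{p. prime p \<and> p \<le> M}. p ^ ?f p)" by simp
      have "real (\<Prod>p\<in>{p. prime p \<and> p \<le> B}. p) \<le> exp (2 * real B)"
        by (rule primorial_le_exp)
      then have "real (\<Prod>p\<in>{p. prime p \<and> p \<le> B}. p) ^ s \<le> exp (2 * real B) ^ s"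
        by (rule power_mono) (rule of_nat_0_le_iff)
      also have "\<dots> = exp (2 * real B * real s)" by (simp add: exp_of_nat_mult[symmetric] mult.commute)
      also have "\<dots> \<le> exp (2 * real B * ((K + 1) * D))" using s_le by (auto intro!: mult_left_mono)
      finally have small: "real (\<Prod>p\<in>{p. prime p \<and> p \<le> B}. p) ^ s \<le> exp (2 * real B * ((K + 1) * D))" .
      have large: "real (\<Prod>p\<in>{p. prime p \<and> p \<le> M}. p ^ ?f p) \<le> exp (22 * (A * D))"
      proof (rule prod_prime_powers_le_exp)
        show AD1: "A * D \<ge> 1" using mult_mono[OF A D1] A by simp
        have "real M \<le> real B + (\<alpha> / \<delta>) powr (1 / \<beta>)" by (simp add: M_def max_def) linarith
        also have "\<dots> \<le> real B * D + \<alpha> powr (1 / \<beta>) * D + D"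
          using D1 mult_left_mono[OF D1, of "real B"] by (simp add: \<alpha>\<delta>)
        also have "\<dots> = A * D" by (simp add: A_def algebra_simps)
        finally show "real M \<le> A * D" .
        fix p :: nat assume p: "prime p" "p \<le> M"
        have p0: "real p \<ge> 1" using prime_gt_0_nat[OF p(1)] by simp
        have "D \<le> A * D" using A D1 by (simp add: mult_le_cancel_right1)
        show "real (p ^ ?f p) \<le> real p * (A * D) ^ 3"
        proof (cases "?f p")
          case 0
          have "1 * 1 \<le> real p * (A * D) ^ 3" using p0 AD1 by (intro mult_mono one_le_power) auto
          then show ?thesis using 0 by simp
        next
          \<comment> \<open>One factor before the final exponent, minimality gives
            \<open>x p ^ i < 1 / \<delta>\<close>, that is \<open>p ^ i < D ^ 3\<close>; the last
            factor costs one more \<open>p\<close>.\<close>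
          case (Suc i)
          then have "p > B" "i < threshold u (x p) s" by (auto split: if_splits)
          then have "u * x p ^ i < real s" by (intro threshold_less)
          then have "x p ^ i < 1 / \<delta>" using s0 that by (simp add: u_def field_simps)
          moreover have "x p ^ i = (real p ^ i) powr (\<beta> / 3)"
            using p0 by (simp add: x_def powr_power powr_powr flip: powr_realpow) (simp add: mult.commute)
          ultimately have "((real p ^ i) powr (\<beta> / 3)) powr (3 / \<beta>) \<le> (1 / \<delta>) powr (3 / \<beta>)"
            using assms by (intro powr_mono2) auto
          also have "\<dots> = D ^ 3"
            using assms D1 by (simp add: D\<beta>[symmetric] powr_powr)
          finally have "real p ^ i \<le> D ^ 3" using assms p0 by (simp add: powr_powr)
          also have "\<dots> \<le> (A * D) ^ 3" using \<open>D \<le> A * D\<close> D1 by (intro power_mono) auto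
          finally have "real p * real p ^ i \<le> real p * (A * D) ^ 3" by (intro mult_left_mono) auto
          then show ?thesis using Suc by simp
        qed
      qed
      have "real (d s) \<le> exp (2 * real B * ((K + 1) * D)) * exp (22 * (A * D))"
        unfolding ds using small large by (rule mult_mono) (rule exp_ge_zero, rule of_nat_0_le_iff)
      also have "\<dots> = exp (c * D)" by (simp add: c_def algebra_simps flip: exp_add)
      finally show ?thesis .
    qed

    \<comment> \<open>Lower bound for the sum, by size of the prime\<close>
    have "(\<Sum>j=0..s. tau \<alpha> \<beta> l (d j) q) \<ge> - \<delta> * (real s + 1)" if q: "q > 0" for q
      using assms(1,2,4) q d_pos d_dvd
    proof (rule sum_tau_ge[where s = s])
      assume "(\<Sum>j=0..s. tau \<alpha> \<beta> l (d j) q) \<ge> 0"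
      moreover have "- \<delta> * (real s + 1) \<le> 0" using \<open>\<delta> > 0\<close> by simp
      ultimately show ?thesis by linarith
    next
      fix p k
      assume p: "prime p" and k: "k \<le> s"
        and drop: "k < s \<Longrightarrow> multiplicity p (d k) < multiplicity p (d (Suc k))"
        and ge: "(\<Sum>j=0..s. tau \<alpha> \<beta> l (d j) q) \<ge> real (s - k) -
        \<alpha> * (\<Sum>j\<le>k. (real p powr - \<beta>) ^ (1 + (multiplicity p (d k) - multiplicity p (d j))))"
          (is "_ \<ge> _ - \<alpha> * ?S")
      have "\<alpha> * ?S \<le> real (s - k) + \<delta> * (real s + 1)"
      proof -
        consider "p > M" | "p \<le> B" | "B < p" "p \<le> M" by linarith
        then show ?thesis
        proof cases
          case 1
          \<comment> \<open>Such \<open>p\<close> divides no \<open>d j\<close>, so all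
            \<open>k + 1\<close> terms equal
            \<open>\<alpha> * p powr - \<beta> \<le> \<delta>\<close>.\<close>
          then have "nat \<lfloor>(\<alpha> / \<delta>) powr (1 / \<beta>)\<rfloor> < p" by (simp add: M_def)
          then have "(\<alpha> / \<delta>) powr (1 / \<beta>) \<le> real p" by linarith
          then have "((\<alpha> / \<delta>) powr (1 / \<beta>)) powr \<beta> \<le> real p powr \<beta>"
            using assms by (intro powr_mono2) auto
          then have "\<alpha> / \<delta> \<le> real p powr \<beta>" using assms \<open>\<delta> > 0\<close> by (simp add: powr_powr)
          then have "\<alpha> * real p powr - \<beta> \<le> \<delta>"
            using \<open>\<delta> > 0\<close> prime_gt_0_nat[OF p] by (simp add: powr_minus_divide field_simps)
          then have "(real k + 1) * (\<alpha> * real p powr - \<beta>) \<le> (real s + 1) * \<delta>"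
            using k assms by (intro mult_mono) auto
          moreover have "\<alpha> * ?S = (real k + 1) * (\<alpha> * real p powr - \<beta>)"
            using 1 p by (simp add: mult_d)
          moreover have "real (s - k) \<ge> 0" by simp
          ultimately show ?thesis unfolding mult.commute[of \<delta>] by linarith
        next
          case 2
          have "?S = (\<Sum>j\<le>k. (real p powr - \<beta>) ^ (1 + (k - j)))"
            using 2 p by (simp add: mult_d e_def M_def)
          also have "\<dots> \<le> (\<Sum>j\<le>k. w ^ (1 + (k - j)))"
            unfolding w_def using prime_ge_2_nat[OF p] assms
            by (intro sum_mono power_mono powr_mono2') auto
          also have "\<dots> \<le> 1 / (1 - w)" using w by (intro sum_power_le_geometric) auto
          finally have "\<alpha> * ?S \<le> \<alpha> * (1 / (1 - w))" using assms by (intro mult_left_mono) auto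
          also have "\<dots> \<le> \<delta> * (real s + 1)"
            using uK \<open>\<delta> > 0\<close> by (simp add: K_def u_def algebra_simps)
          finally show ?thesis by simp
        next
          case 3
          let ?t = "\<lambda>j. threshold u (x p) (s - j)"
          have x1: "x p > 1" using x 3 by simp
          have t0: "?t j \<le> threshold u (x p) s" for j using u x1 by (intro threshold_mono) auto
          have t: "multiplicity p (d k) - multiplicity p (d j) = ?t j - ?t k" for j
            using 3 p t0[of k] t0[of j] by (simp add: mult_d e_def)
          have "?t (Suc k) < ?t k" if "k < s"
            using drop[OF that] 3 p by (simp add: mult_d e_def)
          then have S: "(\<Sum>j\<le>k. (1 / x p) ^ (2 * (1 + (?t j - ?t k)))) \<le> 8 * (real (s - k) + u)"
            using u x1 k by (intro sum_power_threshold_le) auto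
          have "real p powr - \<beta> = (1 / x p) ^ 3"
            using prime_gt_0_nat[OF p] by (simp add: x_def powr_power powr_minus_divide power_one_over)
          \<comment> \<open>One third of the decay yields the small factor \<open>1 / x p\<close>, the rest makes the sum converge.\<close>
          moreover have "((1 / x p) ^ 3) ^ (1 + n) \<le> (1 / x p) * (1 / x p) ^ (2 * (1 + n))" for n
          proof -
            have "((1 / x p) ^ 3) ^ (1 + n) = (1 / x p) ^ (3 * (1 + n))" by (simp only: power_mult)
            also have "\<dots> \<le> (1 / x p) ^ Suc (2 * (1 + n))"
              using x1 by (intro power_decreasing) auto
            finally show ?thesis by (simp only: power_Suc)
          qed
          ultimately have "?S \<le> (\<Sum>j\<le>k. (1 / x p) * (1 / x p) ^ (2 * (1 + (?t j - ?t k))))"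
            unfolding t by (intro sum_mono) auto
          also have "\<dots> \<le> (1 / x p) * (8 * (real (s - k) + u))"
            unfolding sum_distrib_left[symmetric] using S x1 by (intro mult_left_mono) auto
          finally have "\<alpha> * ?S \<le> \<alpha> * ((1 / x p) * (8 * (real (s - k) + u)))"
            using assms by (intro mult_left_mono) auto
          also have "\<dots> = (\<alpha> * (1 / x p)) * (8 * (real (s - k) + u))" by (simp only: mult.assoc)
          \<comment> \<open>The positive terms absorb \<open>s - k\<close>, and
            \<open>u = \<delta> * s\<close> is within the allowed error.\<close>
          also have "\<dots> \<le> (1 / 8) * (8 * (real (s - k) + u))"
            using x[of p] 3 u by (intro mult_right_mono) auto
          also have "\<dots> \<le> real (s - k) + \<delta> * (real s + 1)"
            using \<open>\<delta> > 0\<close> by (simp add: u_def algebra_simps)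
          finally show ?thesis .
        qed
      qed
      then show ?thesis using ge by simp
    qed
    moreover have "real (d s) \<le> 2 * exp (c * D)" using size by (smt (verit) exp_gt_zero)
    ultimately show ?thesis using s0 d0 d_less unfolding D_def by blast
  qed
  show ?thesis
  proof (rule exI[of _ 2], rule exI[of _ c], intro conjI allI impI)
    fix \<delta> :: real assume "\<delta> > 0"
    from main[OF this] obtain s :: nat and d :: "nat \<Rightarrow> nat" where
      sd: "s > 0" "d 0 = 1" "\<forall>j<s. d j < d (Suc j)"
         "real (d s) \<le> 2 * exp (c * \<delta> powr (- 1 / \<beta>))"
      and ge: "\<And>q. q > 0 \<Longrightarrow> (\<Sum>j=0..s. tau \<alpha> \<beta> l (d j) q) \<ge> - \<delta> * (real s + 1)"
      by blast
    \<comment> \<open>Equal weights: \<open>lam = 1\<close>, with total weight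
      \<open>s + 1\<close>.\<close>
    have "1 / (\<Sum>j=0..s. 1 ^ j) * (\<Sum>j=0..s. 1 ^ j * tau \<alpha> \<beta> l (d j) q) \<ge> - \<delta>" if "q > 0" for q
      using ge[OF that] by (simp add: field_simps)
    with sd show "\<exists>(s::nat) (d :: nat \<Rightarrow> nat) (lam::real).
         s > 0 \<and> d 0 = 1 \<and> (\<forall>j<s. d j < d (Suc j)) \<and>
         real (d s) \<le> 2 * exp (c * \<delta> powr (- 1 / \<beta>)) \<and>
         lam > 0 \<and>
         (\<forall>q::nat. q > 0 \<longrightarrow>
            1 / (\<Sum>j=0..s. lam ^ j) * (\<Sum>j=0..s. lam ^ j * tau \<alpha> \<beta> l (d j) q) \<ge> - \<delta>)"
      by (intro exI[of _ s] exI[of _ d] exI[of _ 1]) auto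
  qed (use c in auto)
qed

end
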